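(* Let $1\le p<\gamma\le 2$, let $T>0$, and let $x:[0,T]\to\mathbb{R}^d$ be a continuous path of finite $p$-variation (in the sense given in the context). Let $f=(f^i_j)\in C^{\gamma-1}$ and $y_0\in\mathbb{R}^n$. Then there exist $\tau$ with $0<\tau\le T$ and a solution $y(t)$, for $0\le t<\tau$, of $$dy^i=\sum_{j=1}^d f^i_j(y)\,dx^j,\qquad y^i(0)=y^i_0,\quad i=1,\dots,n,$$ such that if $\tau<T$ then $|y(t)|\to\infty$ as $t\to\tau$.
   Context: $n,d$ are positive integers. For $\rho=N+\alpha$ with $N\ge 0$ an integer and $0<\alpha\le 1$, $C^\rho$ is the set of $f=(f^i_j)_{1\le i\le n,\,1\le j\le d}$ such that each $f^i_j:\mathbb{R}^n\to\mathbb{R}$ has derivatives up to order $N$, all of which satisfy locally a Hölder condition of exponent $\alpha$ (so for integer $\rho$ the derivatives of order $\rho-1$ are locally Lipschitz). Finite $p$-variation: there is a continuous increasing function $\omega$ on $[0,T]$ with $|x(t)-x(s)|^p\le\omega(t)-\omega(s)$ for $0\le s\le t\le T$. Solution: $y:[0,t_1]\to\mathbb{R}^n$ is a solution on $[0,t_1]$ if $y(0)=y_0$ and there exist a continuous increasing function $\tilde\omega$ on $[0,t_1]$ and a non-negative function $\theta$ on $[0,\infty)$ with $\theta(\delta)=o(\delta)$ as $\delta\to0$ such that for all $i$ and all $0\le s<t\le t_1$ $$\Big|y^i(t)-y^i(s)-\sum_j f^i_j(y(s))(x^j(t)-x^j(s))\Big|\le\theta(\tilde\omega(t)-\tilde\omega(s)).$$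 A solution for $0\le t<\tau$ is a function on $[0,\tau)$ whose restriction to $[0,t_1]$ is a solution on $[0,t_1]$ for every $t_1<\tau$. *)

theory Defs
  imports "HOL-Analysis.Analysis" "HOL-Library.Landau_Symbols"
begin

definition locally_hoelder :: "real \<Rightarrow> ('a::metric_space \<Rightarrow> real) \<Rightarrow> bool" where
  "locally_hoelder \<alpha> g \<longleftrightarrow>
     (\<forall>a. \<exists>r>0. \<exists>C. \<forall>u\<in>ball a r. \<forall>v\<in>ball a r. \<bar>g u - g v\<bar> \<le> C * dist u v powr \<alpha>)"

text \<open>Derivatives are taken as iterated partial derivatives along the coordinate axes.\<close>

primrec hoelder_derivs :: "nat \<Rightarrow> real \<Rightarrow> (real^'n \<Rightarrow> real) \<Rightarrow> bool" where
  "hoelder_derivs 0 \<alpha> g \<longleftrightarrow> locally_hoelder \<alpha> g"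
| "hoelder_derivs (Suc N) \<alpha> g \<longleftrightarrow> locally_hoelder \<alpha> g \<and> (\<forall>y. g differentiable (at y)) \<and>
     (\<forall>k. hoelder_derivs N \<alpha> (\<lambda>y. frechet_derivative g (at y) (axis k 1)))"

text \<open>The exponent \<open>\<alpha>\<close> ranges over \<open>0 < \<alpha> \<le> 1\<close>, so integer \<open>\<rho>\<close> means locally
  Lipschitz derivatives of order \<open>\<rho> - 1\<close>, not continuous derivatives of order \<open>\<rho>\<close>.\<close>

definition C_class :: "real \<Rightarrow> ('n \<Rightarrow> 'd \<Rightarrow> real^'n \<Rightarrow> real) set" where
  "C_class \<rho> = {f. \<exists>N \<alpha>. \<rho> = real N + \<alpha> \<and> 0 < \<alpha> \<and> \<alpha> \<le> 1 \<and> (\<forall>i j. hoelder_derivs N \<alpha> (f i j))}"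

definition finite_p_variation :: "real \<Rightarrow> real \<Rightarrow> (real \<Rightarrow> 'a::real_normed_vector) \<Rightarrow> bool" where
  "finite_p_variation p T x \<longleftrightarrow>
     (\<exists>\<omega> :: real \<Rightarrow> real. continuous_on {0..T} \<omega> \<and> mono_on {0..T} \<omega> \<and>
        (\<forall>s t. 0 \<le> s \<and> s \<le> t \<and> t \<le> T \<longrightarrow> norm (x t - x s) powr p \<le> \<omega> t - \<omega> s))"

text \<open>The Landau condition on \<open>\<theta>\<close> says nothing about the value at \<open>0\<close>, since the filter
  excludes that point. As \<open>\<omega>\<close> need not be strictly increasing, \<open>\<theta> 0\<close> can occur on the
  right-hand side below, and \<open>\<theta>(\<delta>) = o(\<delta>)\<close> for \<open>\<delta> \<ge> 0\<close> includes \<open>\<theta> 0 = 0\<close>.\<close>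

definition solution_on ::
  "('n \<Rightarrow> 'd \<Rightarrow> real^'n \<Rightarrow> real) \<Rightarrow> (real \<Rightarrow> real^'d) \<Rightarrow> real^'n \<Rightarrow> real \<Rightarrow> (real \<Rightarrow> real^'n) \<Rightarrow> bool"
where
  "solution_on f x y0 t1 y \<longleftrightarrow> y 0 = y0 \<and>
     (\<exists>(\<omega> :: real \<Rightarrow> real) (\<theta> :: real \<Rightarrow> real).
        continuous_on {0..t1} \<omega> \<and> mono_on {0..t1} \<omega> \<and>
        (\<forall>\<delta>\<ge>0. \<theta> \<delta> \<ge> 0) \<and> \<theta> 0 = 0 \<and> \<theta> \<in> o[at_right 0](\<lambda>\<delta>. \<delta>) \<and>
        (\<forall>i s t. 0 \<le> s \<and> s < t \<and> t \<le> t1 \<longrightarrow>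
           \<bar>y t $ i - y s $ i - (\<Sum>j\<in>UNIV. f i j (y s) * (x t $ j - x s $ j))\<bar> \<le> \<theta> (\<omega> t - \<omega> s)))"

definition solution_before ::
  "('n \<Rightarrow> 'd \<Rightarrow> real^'n \<Rightarrow> real) \<Rightarrow> (real \<Rightarrow> real^'d) \<Rightarrow> real^'n \<Rightarrow> real \<Rightarrow> (real \<Rightarrow> real^'n) \<Rightarrow> bool"
where
  "solution_before f x y0 \<tau> y \<longleftrightarrow> (\<forall>t1. 0 \<le> t1 \<and> t1 < \<tau> \<longrightarrow> solution_on f x y0 t1 y)"

end

theory Submission
  imports Defs
begin

text \<open>
  Write \<open>\<alpha> = \<gamma> - 1\<close>; since \<open>\<alpha> \<le> 1\<close>, the class \<open>C\<^sup>\<alpha>\<close> consists of locally Hoelder functions, and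
  \<open>q = (1 + \<alpha>) / p = \<gamma> / p > 1\<close>. The Euler scheme on any finite partition of a short interval
  satisfies \<open>|y(t) - y(s) - f(y(s)) (x(t) - x(s))| \<le> C (\<omega>(t) - \<omega>(s))\<^sup>q\<close> at all partition points
  with \<open>C\<close> independent of the partition: splitting \<open>[s, t]\<close> where the control is halved gains a factor
  \<open>2\<^bsup>1-q\<^esup> < 1\<close>, which absorbs the Hoelder cross terms. For each pair \<open>s \<le> t\<close> the functions obeying
  this bound form a closed set in the product topology, so by Tychonoff and the finite intersection
  property some function obeys it for all pairs at once.

  The amount \<open>W\<close> of control that a local solution can consume while moving a distance at most \<open>1\<close>
  depends only on a bound for its starting point. Concatenating local solutions, either the endpoint
  \<open>T\<close> is reached, or infinitely many steps fit into the finite total control, so that \<open>W\<close> tends to \<open>0\<close>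
  along the starting points, which must therefore tend to infinity.
\<close>

subsection \<open>Uniform estimates for the Euler scheme\<close>

lemma norm_matrix_vector_mult_le: "norm (A *v v) \<le> norm A * norm v"
  for A :: "real^'d^'n"
proof -
  have "norm (A *v v) = L2_set (\<lambda>i. norm ((A *v v) $ i)) UNIV"
    by (simp add: norm_vec_def)
  also have "\<dots> \<le> L2_set (\<lambda>i. norm (A $ i) * norm v) UNIV"
    by (intro L2_set_mono) (auto simp: matrix_vector_mul_component Cauchy_Schwarz_ineq2)
  also have "\<dots> = norm A * norm v"
    by (simp add: norm_vec_def[of A] L2_set_left_distrib)
  finally show ?thesis .
qed

text \<open>Splitting the exponent as \<open>\<alpha> / p + 1 / p\<close>, the remainder is at most
  \<open>C * W powr (\<alpha> / p)\<close> times \<open>\<delta> powr (1 / p)\<close> and merges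
  with the main term. When that factor is at most 1, increments are controlled by
  \<open>M + 1\<close>, independently of \<open>C\<close>.\<close>

lemma increment_bound:
  fixes A :: "real^'d^'n"
  assumes "norm (v - A *v w) \<le> C * \<delta> powr ((1 + \<alpha>) / p)" and "norm A \<le> M"
    and "norm w \<le> \<delta> powr (1 / p)" and "0 \<le> \<delta>" "\<delta> \<le> W" and "M + C * W powr (\<alpha> / p) \<le> K"
    and "0 \<le> C" "0 < \<alpha>" "0 < p"
  shows "norm v \<le> K * \<delta> powr (1 / p)"
proof -
  have "C * \<delta> powr (\<alpha> / p) \<le> C * W powr (\<alpha> / p)"
    using assms by (intro mult_left_mono powr_mono2) auto
  then have "C * \<delta> powr (\<alpha> / p) * \<delta> powr (1 / p) \<le> (K - M) * \<delta> powr (1 / p)"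
    using assms by (intro mult_right_mono) auto
  moreover have "\<delta> powr ((1 + \<alpha>) / p) = \<delta> powr (\<alpha> / p) * \<delta> powr (1 / p)"
    by (simp add: powr_add[symmetric] add_divide_distrib add.commute)
  ultimately have J: "norm (v - A *v w) \<le> (K - M) * \<delta> powr (1 / p)"
    using assms(1) by (simp add: mult.assoc)
  have "norm (A *v w) \<le> norm A * norm w"
    by (rule norm_matrix_vector_mult_le)
  also have "\<dots> \<le> M * \<delta> powr (1 / p)"
    using assms by (intro mult_mono) (auto intro: order_trans[OF norm_ge_zero])
  finally have "norm (A *v w) \<le> M * \<delta> powr (1 / p)" .
  moreover have "norm v \<le> norm (v - A *v w) + norm (A *v w)"
    using norm_triangle_ineq[of "v - A *v w" "A *v w"] by simp
  ultimately show ?thesis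
    using J by (simp add: algebra_simps)
qed

text \<open>Such a term arises when the coefficient at the start of an interval is replaced by the
  one at an intermediate point. The Hoelder gain \<open>\<alpha> / p\<close> adds to the
  \<open>1 / p\<close> of the driving increment, which gives the order of the remainder.\<close>

lemma hoelder_cross_term:
  fixes g :: "real^'n \<Rightarrow> real^'d^'n"
  assumes H: "norm (g u - g v) \<le> H * norm (u - v) powr \<alpha>" "0 \<le> H"
    and uv: "norm (u - v) \<le> K * \<delta> powr (1 / p)" and w: "norm w \<le> \<delta> powr (1 / p)"
    and "0 \<le> K" "0 < \<alpha>" "0 \<le> \<delta>"
  shows "norm ((g u - g v) *v w) \<le> H * K powr \<alpha> * \<delta> powr ((1 + \<alpha>) / p)"
proof -
  have "norm (u - v) powr \<alpha> \<le> (K * \<delta> powr (1 / p)) powr \<alpha>"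
    using assms by (intro powr_mono2) auto
  also have "\<dots> = K powr \<alpha> * \<delta> powr (\<alpha> / p)"
    using assms by (simp add: powr_mult powr_powr)
  finally have "norm (g u - g v) \<le> H * (K powr \<alpha> * \<delta> powr (\<alpha> / p))"
    using H by (meson mult_left_mono order_trans)
  then have "norm (g u - g v) * norm w \<le> H * (K powr \<alpha> * \<delta> powr (\<alpha> / p)) * \<delta> powr (1 / p)"
    using assms by (intro mult_mono) auto
  also have "\<dots> = H * K powr \<alpha> * \<delta> powr ((1 + \<alpha>) / p)"
    by (simp add: powr_add[symmetric] add_divide_distrib add.commute)
  finally show ?thesis
    using norm_matrix_vector_mult_le order_trans by blast
qed

text \<open>Strong induction on the number of grid steps. The first inequality for \<open>C\<close>
  closes the induction; \<open>CW\<close> keeps the increment constant at \<open>M + 1\<close>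
  instead of one growing with \<open>C\<close>. Neither involves \<open>N\<close>, so the bound is
  uniform over grids.\<close>

lemma euler_estimate:
  fixes g :: "real^'n \<Rightarrow> real^'d^'n" and X :: "nat \<Rightarrow> real^'d" and \<omega> :: "nat \<Rightarrow> real"
  assumes \<alpha>: "0 < \<alpha>" and p: "1 \<le> p"
    and mono: "\<And>k m. k \<le> m \<Longrightarrow> m < N \<Longrightarrow> \<omega> k \<le> \<omega> m"
    and X: "\<And>k m. k \<le> m \<Longrightarrow> m < N \<Longrightarrow> norm (X m - X k) \<le> (\<omega> m - \<omega> k) powr (1 / p)"
    and W: "\<And>k m. k \<le> m \<Longrightarrow> m < N \<Longrightarrow> \<omega> m - \<omega> k \<le> W"
    and y: "\<And>k. Suc k < N \<Longrightarrow> y (Suc k) = y k + g (y k) *v (X (Suc k) - X k)"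
    and M: "\<And>u. norm (g u) \<le> M"
    and H: "\<And>u v. norm (g u - g v) \<le> H * norm (u - v) powr \<alpha>" "0 \<le> H"
    and C: "2 powr (1 - (1 + \<alpha>) / p) * C + 2 * (H * (M + 1) powr \<alpha>) \<le> C" "0 \<le> C"
    and CW: "C * W powr (\<alpha> / p) \<le> 1"
    and "k \<le> m" "m < N"
  shows "norm (y m - y k - g (y k) *v (X m - X k)) \<le> C * (\<omega> m - \<omega> k) powr ((1 + \<alpha>) / p)"
  using \<open>k \<le> m\<close> \<open>m < N\<close>
proof (induction "m - k" arbitrary: k m rule: less_induct)
  case less
  define q where "q = (1 + \<alpha>) / p"
  define \<delta> where "\<delta> = \<omega> m - \<omega> k"
  define J where "J k m = y m - y k - g (y k) *v (X m - X k)" for k m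
  have \<delta>0: "0 \<le> \<delta>" and q0: "0 < q" and M0: "0 \<le> M"
    using mono less.prems \<alpha> p M[of undefined] order_trans[OF norm_ge_zero]
    by (auto simp: \<delta>_def q_def)
  show ?case
  proof (cases "m \<le> Suc k")
    case True
    then have "J k m = 0"
      using less.prems y[of k] le_Suc_eq[of m k] by (auto simp: J_def)
    then show ?thesis
      using C by (simp add: J_def)
  next
    case False
    \<comment> \<open>\<open>l\<close> is the last index before \<open>m\<close> reached with at
      most half of the control, so at most half remains after \<open>Suc l\<close>. The step from
      \<open>l\<close> to \<open>Suc l\<close> may carry most of the control, but as an exact Euler
      step it has no remainder; hence the split leaves out one whole step.\<close>
    define L where "L = {l. k \<le> l \<and> l < m \<and> \<omega> l - \<omega> k \<le> \<delta> / 2}"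
    define l where "l = Max L"
    have "finite L" "k \<in> L"
      using False \<delta>0 by (auto simp: L_def)
    then have "l \<in> L"
      unfolding l_def by (metis Max_in empty_iff)
    then have l: "k \<le> l" "l < m" "\<omega> l - \<omega> k \<le> \<delta> / 2"
      by (auto simp: L_def)
    have l': "\<omega> m - \<omega> (Suc l) \<le> \<delta> / 2"
    proof (cases "Suc l = m")
      case True
      then show ?thesis using \<delta>0 by simp
    next
      case False
      have "Suc l \<notin> L"
        using Max_ge[OF \<open>finite L\<close>, of "Suc l"] by (auto simp: l_def)
      then show ?thesis
        using l False by (auto simp: L_def \<delta>_def field_simps)
    qed
    have half: "C * d powr q \<le> C * (\<delta> / 2) powr q" if "0 \<le> d" "d \<le> \<delta> / 2" for d
      using that q0 C by (intro mult_left_mono powr_mono2) auto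
    have "norm (J k l) \<le> C * (\<omega> l - \<omega> k) powr q"
      unfolding J_def q_def using l less.prems by (intro less.hyps) auto
    also note half
    finally have J1: "norm (J k l) \<le> C * (\<delta> / 2) powr q"
      using l less.prems mono by auto
    have "norm (J (Suc l) m) \<le> C * (\<omega> m - \<omega> (Suc l)) powr q"
      unfolding J_def q_def using l less.prems by (intro less.hyps) auto
    also note half
    finally have J2: "norm (J (Suc l) m) \<le> C * (\<delta> / 2) powr q"
      using l' l less.prems mono by auto
    have le\<delta>: "\<omega> b - \<omega> a \<le> \<delta>" "0 \<le> \<omega> b - \<omega> a" if "k \<le> a" "a \<le> b" "b \<le> m" for a b
      using that less.prems mono[of k a] mono[of b m] mono[of a b] by (auto simp: \<delta>_def)
    have X\<delta>: "norm (X b - X a) \<le> \<delta> powr (1 / p)" if "k \<le> a" "a \<le> b" "b \<le> m" for a b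
    proof -
      have "norm (X b - X a) \<le> (\<omega> b - \<omega> a) powr (1 / p)"
        using X that less.prems by simp
      also have "\<dots> \<le> \<delta> powr (1 / p)"
        using le\<delta>[OF that] p by (intro powr_mono2) auto
      finally show ?thesis .
    qed
    have y\<delta>: "norm (y b - y a) \<le> (M + 1) * \<delta> powr (1 / p)"
      if ab: "k \<le> a" "a \<le> b" "b \<le> m" and J: "norm (J a b) \<le> C * (\<omega> b - \<omega> a) powr q" for a b
    proof -
      have "norm (y b - y a) \<le> (M + 1) * (\<omega> b - \<omega> a) powr (1 / p)"
        using J X[of a b] W[of a b] le\<delta>[OF ab] ab less.prems C CW \<alpha> p
        by (intro increment_bound[where A = "g (y a)" and w = "X b - X a" and C = C and W = W and \<alpha> = \<alpha> and M = M])
          (auto simp: J_def q_def M)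
      also have "\<dots> \<le> (M + 1) * \<delta> powr (1 / p)"
        using le\<delta>[OF ab] p M0 by (intro mult_left_mono powr_mono2) auto
      finally show ?thesis .
    qed
    have y1: "norm (y l - y k) \<le> (M + 1) * \<delta> powr (1 / p)"
      using l less by (intro y\<delta>) (auto simp: J_def q_def)
    have "J l (Suc l) = 0"
      using y[of l] l less.prems by (auto simp: J_def)
    then have y2: "norm (y (Suc l) - y l) \<le> (M + 1) * \<delta> powr (1 / p)"
      using l C by (intro y\<delta>) auto
    have c1: "norm ((g (y l) - g (y k)) *v (X m - X l)) \<le> H * (M + 1) powr \<alpha> * \<delta> powr q"
      unfolding q_def using H y1 X\<delta>[of l m] l M0 \<alpha> \<delta>0 by (intro hoelder_cross_term) auto
    have c2: "norm ((g (y (Suc l)) - g (y l)) *v (X m - X (Suc l))) \<le> H * (M + 1) powr \<alpha> * \<delta> powr q"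
      unfolding q_def using H y2 X\<delta>[of "Suc l" m] l M0 \<alpha> \<delta>0 by (intro hoelder_cross_term) auto
    \<comment> \<open>Telescoping over \<open>k\<close>, \<open>l\<close>, \<open>Suc l\<close>,
      \<open>m\<close>: the middle remainder \<open>J l (Suc l)\<close> is zero, and each change of
      base point leaves one cross term.\<close>
    have "J k m = J k l + J (Suc l) m + (g (y l) - g (y k)) *v (X m - X l)
        + (g (y (Suc l)) - g (y l)) *v (X m - X (Suc l))"
      using y[of l] l less.prems
      by (simp add: J_def matrix_vector_mult_diff_distrib matrix_vector_mult_diff_rdistrib)
    then have "norm (J k m) \<le> norm (J k l) + norm (J (Suc l) m)
        + norm ((g (y l) - g (y k)) *v (X m - X l))
        + norm ((g (y (Suc l)) - g (y l)) *v (X m - X (Suc l)))"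
      by (smt (verit) norm_triangle_ineq)
    also have "\<dots> \<le> 2 * (C * (\<delta> / 2) powr q) + 2 * (H * (M + 1) powr \<alpha> * \<delta> powr q)"
      using J1 J2 c1 c2 by simp
    also have "(\<delta> / 2) powr q = \<delta> powr q / 2 powr q"
      using \<delta>0 by (simp add: powr_divide)
    also have "2 * (C * (\<delta> powr q / 2 powr q)) = 2 powr (1 - q) * C * \<delta> powr q"
      by (simp add: powr_diff)
    also have "2 powr (1 - q) * C * \<delta> powr q + 2 * (H * (M + 1) powr \<alpha> * \<delta> powr q)
        = (2 powr (1 - q) * C + 2 * (H * (M + 1) powr \<alpha>)) * \<delta> powr q"
      by (simp add: algebra_simps)
    also have "\<dots> \<le> C * \<delta> powr q"
      using C by (intro mult_right_mono) (auto simp: q_def)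
    finally show ?thesis
      by (simp add: J_def q_def \<delta>_def)
  qed
qed

subsection \<open>Local existence by compactness\<close>

text \<open>The constant stays existential because it changes under concatenation. A free left
  endpoint without an initial value lets pieces be solved separately. The sign of \<open>C\<close>
  is left open, so later arguments pass to a nonnegative constant.\<close>

definition davie_solution ::
  "(real^'n \<Rightarrow> real^'d^'n) \<Rightarrow> (real \<Rightarrow> real^'d) \<Rightarrow> (real \<Rightarrow> real) \<Rightarrow> real \<Rightarrow> real \<Rightarrow> real
    \<Rightarrow> (real \<Rightarrow> real^'n) \<Rightarrow> bool"
where
  "davie_solution g x \<omega> q a b y \<longleftrightarrow>
     (\<exists>C. \<forall>s t. a \<le> s \<and> s \<le> t \<and> t \<le> b \<longrightarrow>
        norm (y t - y s - g (y s) *v (x t - x s)) \<le> C * (\<omega> t - \<omega> s) powr q)"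

text \<open>Tychonoff's theorem: the topology on a function type is the product topology, and the
  set is a product of copies of \<open>K\<close>.\<close>

lemma compact_fun_range:
  fixes K :: "'b::topological_space set"
  assumes "compact K"
  shows "compact {y :: 'a \<Rightarrow> 'b. \<forall>t. y t \<in> K}"
proof -
  have "compactin (product_topology (\<lambda>_. euclidean) UNIV) (PiE (UNIV :: 'a set) (\<lambda>_. K))"
    using assms by (simp add: compactin_PiE)
  then show ?thesis
    by (simp add: euclidean_product_topology PiE_UNIV_domain Pi_def)
qed

text \<open>The finite subproblem for the finite intersection property: run the Euler scheme on the
  sorted points of \<open>S\<close> and read it back as a function of time.\<close>

lemma euler_finite_set:
  fixes g :: "real^'n \<Rightarrow> real^'d^'n" and x :: "real \<Rightarrow> real^'d"
  assumes \<alpha>: "0 < \<alpha>" and p: "1 \<le> p"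
    and \<omega>: "mono_on {a..b} \<omega>" "\<omega> b - \<omega> a \<le> W"
    and x: "\<And>s t. a \<le> s \<Longrightarrow> s \<le> t \<Longrightarrow> t \<le> b \<Longrightarrow> norm (x t - x s) \<le> (\<omega> t - \<omega> s) powr (1 / p)"
    and M: "\<And>u. norm (g u) \<le> M"
    and H: "\<And>u v. norm (g u - g v) \<le> H * norm (u - v) powr \<alpha>" "0 \<le> H"
    and C: "2 powr (1 - (1 + \<alpha>) / p) * C + 2 * (H * (M + 1) powr \<alpha>) \<le> C" "0 \<le> C"
    and CW: "C * W powr (\<alpha> / p) \<le> 1"
    and S: "finite S" "S \<subseteq> {a..b}" "a \<in> S"
  shows "\<exists>y. y a = y0 \<and> (\<forall>s\<in>S. \<forall>t\<in>S. s \<le> t \<longrightarrow>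
    norm (y t - y s - g (y s) *v (x t - x s)) \<le> C * (\<omega> t - \<omega> s) powr ((1 + \<alpha>) / p))"
proof -
  define ts where "ts = sorted_list_of_set S"
  define N where "N = length ts"
  define Y where "Y = rec_nat y0 (\<lambda>k u. u + g u *v (x (ts ! Suc k) - x (ts ! k)))"
  \<comment> \<open>Inverse of the enumeration on \<open>S\<close>. Off \<open>S\<close> the value
    is unspecified, and the claim evaluates it only on \<open>S\<close>.\<close>
  define idx where "idx s = (THE k. k < N \<and> ts ! k = s)" for s
  have ts: "sorted ts" "distinct ts" "set ts = S"
    using S by (auto simp: ts_def)
  have tsS: "ts ! k \<in> {a..b}" if "k < N" for k
    using that S ts nth_mem[of k ts] by (auto simp: N_def)
  have ts_le: "ts ! k \<le> ts ! m" if "k \<le> m" "m < N" for k m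
    using that ts by (auto simp: N_def sorted_nth_mono)
  have idx: "idx s < N \<and> ts ! idx s = s" if "s \<in> S" for s
    unfolding idx_def
  proof (rule theI')
    show "\<exists>!k. k < N \<and> ts ! k = s"
      using that ts nth_eq_iff_index_eq[of ts] unfolding N_def by (metis in_set_conv_nth)
  qed
  have idx_le: "idx s \<le> idx t" if "s \<in> S" "t \<in> S" "s \<le> t" for s t
    using idx[OF that(1)] idx[OF that(2)] ts_le[of "idx t" "idx s"] that
    by (metis dual_order.antisym linorder_le_cases)
  have "0 < N"
    using S ts by (auto simp: N_def)
  \<comment> \<open>\<open>a\<close> is the smallest point of \<open>S\<close>, so the scheme starts
    there with the value \<open>y0\<close>.\<close>
  then have "ts ! 0 = a"
    using ts_le[of 0 "idx a"] idx[of a] tsS[of 0] S by auto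
  then have "idx a = 0"
    using idx[of a] \<open>0 < N\<close> ts S nth_eq_iff_index_eq[of ts "idx a" 0] by (auto simp: N_def)
  have est: "norm (Y m - Y k - g (Y k) *v (x (ts ! m) - x (ts ! k)))
      \<le> C * (\<omega> (ts ! m) - \<omega> (ts ! k)) powr ((1 + \<alpha>) / p)" if "k \<le> m" "m < N" for k m
  proof (rule euler_estimate[where N = N and W = W and M = M and H = H and X = "\<lambda>k. x (ts ! k)"
        and \<omega> = "\<lambda>k. \<omega> (ts ! k)"])
    show "\<omega> (ts ! m) - \<omega> (ts ! k) \<le> W" if "k \<le> m" "m < N" for k m
      using that tsS[of k] tsS[of m] \<omega> monotone_onD[OF \<omega>(1), of a "ts ! k"]
        monotone_onD[OF \<omega>(1), of "ts ! m" b] by auto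
    show "\<omega> (ts ! k) \<le> \<omega> (ts ! m)" if "k \<le> m" "m < N" for k m
      using that tsS[of k] tsS[of m] ts_le by (intro monotone_onD[OF \<omega>(1)]) auto
    show "norm (x (ts ! m) - x (ts ! k)) \<le> (\<omega> (ts ! m) - \<omega> (ts ! k)) powr (1 / p)"
      if "k \<le> m" "m < N" for k m
      using that tsS[of k] tsS[of m] ts_le by (intro x) auto
    show "Y (Suc k) = Y k + g (Y k) *v (x (ts ! Suc k) - x (ts ! k))" for k
      by (simp add: Y_def)
  qed (use assms that in auto)
  show ?thesis
  proof (intro exI conjI ballI impI)
    show "Y (idx a) = y0"
      using \<open>idx a = 0\<close> by (simp add: Y_def)
    show "norm (Y (idx t) - Y (idx s) - g (Y (idx s)) *v (x t - x s))
        \<le> C * (\<omega> t - \<omega> s) powr ((1 + \<alpha>) / p)" if "s \<in> S" "t \<in> S" "s \<le> t" for s t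
      using est[of "idx s" "idx t"] idx idx_le that by simp
  qed
qed

lemma bounded_bilinear_matrix_vector_mul: "bounded_bilinear ((*v) :: real^'d^'n \<Rightarrow> real^'d \<Rightarrow> real^'n)"
  by (rule bounded_bilinear.intro)
    (auto simp: matrix_vector_mult_add_rdistrib matrix_vector_right_distrib scaleR_matrix_vector_assoc
      linear_scale[OF matrix_vector_mul_linear] intro!: exI[of _ 1] norm_matrix_vector_mult_le)

lemma hoelder_imp_continuous:
  fixes g :: "'a::real_normed_vector \<Rightarrow> 'b::real_normed_vector" and H \<alpha> :: real
  assumes "\<And>u v. norm (g u - g v) \<le> H * norm (u - v) powr \<alpha>" and "0 < \<alpha>"
  shows "continuous_on UNIV g"
  unfolding continuous_on_def
proof
  fix u :: 'a
  have "((\<lambda>v. norm (v - u) powr \<alpha>) \<longlongrightarrow> 0) (at u)"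
    using \<open>0 < \<alpha>\<close> by (intro tendsto_zero_powrI[where b = \<alpha>]) (auto intro!: tendsto_eq_intros)
  then have "((\<lambda>v. H * norm (v - u) powr \<alpha>) \<longlongrightarrow> 0) (at u)"
    by (rule tendsto_mult_right_zero)
  then have "((\<lambda>v. g v - g u) \<longlongrightarrow> 0) (at u)"
    by (rule Lim_null_comparison[rotated]) (simp add: assms(1))
  then show "(g \<longlongrightarrow> g u) (at u)"
    by (rule LIM_zero_cancel)
qed

text \<open>\<open>MW\<close> keeps all grid values in the unit ball around \<open>y0\<close>, so
  every approximation lies in one compact product. Each pair of times imposes a closed constraint,
  and any finitely many of them are met by an Euler scheme; no convergence of the schemes is
  claimed.\<close>

lemma local_solution:
  fixes g :: "real^'n \<Rightarrow> real^'d^'n" and x :: "real \<Rightarrow> real^'d"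
  assumes \<alpha>: "0 < \<alpha>" and p: "1 \<le> p" and "a \<le> b"
    and \<omega>: "mono_on {a..b} \<omega>" "\<omega> b - \<omega> a \<le> W"
    and x: "\<And>s t. a \<le> s \<Longrightarrow> s \<le> t \<Longrightarrow> t \<le> b \<Longrightarrow> norm (x t - x s) \<le> (\<omega> t - \<omega> s) powr (1 / p)"
    and M: "\<And>u. norm (g u) \<le> M"
    and H: "\<And>u v. norm (g u - g v) \<le> H * norm (u - v) powr \<alpha>" "0 \<le> H"
    and C: "2 powr (1 - (1 + \<alpha>) / p) * C + 2 * (H * (M + 1) powr \<alpha>) \<le> C" "0 \<le> C"
    and CW: "C * W powr (\<alpha> / p) \<le> 1" and MW: "(M + 1) * W powr (1 / p) \<le> 1"
  shows "\<exists>y. y a = y0 \<and> (\<forall>s. norm (y s - y0) \<le> 1) \<and> davie_solution g x \<omega> ((1 + \<alpha>) / p) a b y"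
proof -
  define q where "q = (1 + \<alpha>) / p"
  define I where "I = {z. a \<le> fst z \<and> fst z \<le> snd z \<and> snd z \<le> b}"
  \<comment> \<open>Each constraint includes the initial condition; the pair \<open>(a, a)\<close>
    recovers it at the end.\<close>
  define B where "B z = {y. y a = y0 \<and> norm (y (snd z) - y (fst z)
      - g (y (fst z)) *v (x (snd z) - x (fst z))) \<le> C * (\<omega> (snd z) - \<omega> (fst z)) powr q}" for z
  define K :: "(real \<Rightarrow> real^'n) set" where "K = {y. \<forall>t. y t \<in> cball y0 1}"
  have "compact K"
    unfolding K_def by (intro compact_fun_range compact_cball)
  have g_cont: "continuous_on UNIV g"
    using H \<alpha> by (intro hoelder_imp_continuous)
  have M0: "0 \<le> M"
    using M[of undefined] order_trans[OF norm_ge_zero] by blast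
  have "K \<inter> (\<Inter>z\<in>I. B z) \<noteq> {}"
  proof (rule compact_imp_fip_image[OF \<open>compact K\<close>])
    \<comment> \<open>Only the values of \<open>y\<close> at finitely many times enter, and
      evaluation at a time is continuous for the product topology.\<close>
    show "closed (B z)" for z
    proof -
      have g': "continuous_on UNIV (\<lambda>y :: real \<Rightarrow> real^'n. g (y t))" for t
        by (rule continuous_on_compose2[OF g_cont continuous_on_product_coordinates]) auto
      note coord = continuous_on_product_coordinates
      show ?thesis
        unfolding B_def
        by (intro closed_Collect_conj closed_Collect_eq closed_Collect_le continuous_intros
            bounded_bilinear.continuous_on[OF bounded_bilinear_matrix_vector_mul] g' coord)
    qed
  next
    fix Z assume Z: "finite Z" "Z \<subseteq> I"
    define S where "S = insert a (fst ` Z \<union> snd ` Z)"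
    have S: "finite S" "S \<subseteq> {a..b}" "a \<in> S"
      using Z \<open>a \<le> b\<close> by (auto simp: S_def I_def)
    obtain y where y: "y a = y0"
      "\<And>s t. s \<in> S \<Longrightarrow> t \<in> S \<Longrightarrow> s \<le> t \<Longrightarrow> norm (y t - y s - g (y s) *v (x t - x s)) \<le> C * (\<omega> t - \<omega> s) powr q"
      using euler_finite_set[OF \<alpha> p \<omega> x M H C CW S, of y0] unfolding q_def by blast
    have near: "norm (y t - y0) \<le> 1" if "t \<in> S" for t
    proof -
      have t: "a \<le> t" "t \<le> b"
        using that S by auto
      have "0 \<le> \<omega> t - \<omega> a" "\<omega> t - \<omega> a \<le> W"
        using t \<omega> monotone_onD[OF \<omega>(1), of a t] monotone_onD[OF \<omega>(1), of t b] by auto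
      then have "norm (y t - y a) \<le> (M + 1) * (\<omega> t - \<omega> a) powr (1 / p)"
        using y(2)[of a t] that S t x[of a t] CW C \<alpha> p M
        by (intro increment_bound[where A = "g (y a)" and w = "x t - x a" and C = C and W = W and \<alpha> = \<alpha> and M = M])
          (auto simp: q_def)
      also have "\<dots> \<le> (M + 1) * W powr (1 / p)"
        using \<open>0 \<le> \<omega> t - \<omega> a\<close> \<open>\<omega> t - \<omega> a \<le> W\<close> p M0 by (intro mult_left_mono powr_mono2) auto
      finally show ?thesis
        using MW y(1) by simp
    qed
    \<comment> \<open>Values off \<open>S\<close> are reset to \<open>y0\<close> to stay in
      \<open>K\<close>; the constraints from \<open>Z\<close> look only at points of
      \<open>S\<close>.\<close>
    define y' where "y' t = (if t \<in> S then y t else y0)" for t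
    have "y' \<in> K"
      using near by (auto simp: K_def y'_def dist_norm norm_minus_commute)
    moreover have "y' \<in> B z" if "z \<in> Z" for z
    proof -
      have "fst z \<in> S" "snd z \<in> S" "fst z \<le> snd z"
        using that Z by (auto simp: S_def I_def)
      then show ?thesis
        using y S by (auto simp: B_def y'_def)
    qed
    ultimately show "K \<inter> (\<Inter>z\<in>Z. B z) \<noteq> {}"
      by blast
  qed
  then obtain y where yK: "y \<in> K" and y: "\<And>z. z \<in> I \<Longrightarrow> y \<in> B z"
    by blast
  have "y a = y0"
    using y[of "(a, a)"] \<open>a \<le> b\<close> by (auto simp: I_def B_def)
  moreover have "davie_solution g x \<omega> q a b y"
    unfolding davie_solution_def
  proof (intro exI allI impI)
    fix s t assume "a \<le> s \<and> s \<le> t \<and> t \<le> b"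
    then show "norm (y t - y s - g (y s) *v (x t - x s)) \<le> C * (\<omega> t - \<omega> s) powr q"
      using y[of "(s, t)"] by (auto simp: I_def B_def)
  qed
  ultimately show ?thesis
    using yK by (auto simp: K_def q_def dist_norm norm_minus_commute)
qed

subsection \<open>Hoelder functions on compact sets\<close>

text \<open>Two regimes separated by a Lebesgue number \<open>\<delta>\<close>: close points share a
  ball of the cover, where a local constant applies; for points at distance at least
  \<open>\<delta>\<close> a bound for \<open>h\<close> on \<open>K\<close> is enough.\<close>

lemma locally_hoelder_on_compact:
  fixes h :: "'a::metric_space \<Rightarrow> real"
  assumes h: "locally_hoelder \<alpha> h" and K: "compact K" and "0 < \<alpha>"
  shows "\<exists>H\<ge>0. \<forall>u\<in>K. \<forall>v\<in>K. \<bar>h u - h v\<bar> \<le> H * dist u v powr \<alpha>"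
proof (cases "K = {}")
  case False
  obtain r C where r: "\<And>a. 0 < r a"
    and rC: "\<And>a u v. u \<in> ball a (r a) \<Longrightarrow> v \<in> ball a (r a) \<Longrightarrow> \<bar>h u - h v\<bar> \<le> C a * dist u v powr \<alpha>"
    using h unfolding locally_hoelder_def by metis
  obtain D where D: "D \<subseteq> K" "finite D" "K \<subseteq> (\<Union>a\<in>D. ball a (r a))"
    by (rule compactE_image[OF K, of K "\<lambda>a. ball a (r a)"]) (use r in auto)
  obtain \<delta> where "0 < \<delta>" and \<delta>: "\<And>S. S \<subseteq> K \<Longrightarrow> diameter S < \<delta> \<Longrightarrow> \<exists>B\<in>(\<lambda>a. ball a (r a)) ` D. S \<subseteq> B"
    by (rule Lebesgue_number_lemma[OF K, of "(\<lambda>a. ball a (r a)) ` D"]) (use D False in auto)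
  \<comment> \<open>Sums stand in for maxima over the finite cover: \<open>L\<close> dominates every
    local constant, and \<open>B\<close> bounds \<open>h\<close> on \<open>K\<close> by passing
    through the centre of a ball.\<close>
  define L where "L = (\<Sum>a\<in>D. \<bar>C a\<bar>)"
  define B where "B = (\<Sum>a\<in>D. \<bar>h a\<bar> + \<bar>C a\<bar> * r a powr \<alpha>)"
  have "0 \<le> L" "0 \<le> B"
    using r by (auto simp: L_def B_def intro!: sum_nonneg)
  have bound: "\<bar>h u\<bar> \<le> B" if u: "u \<in> K" for u
  proof -
    obtain a where a: "a \<in> D" "u \<in> ball a (r a)"
      using D u by blast
    have "\<bar>h u - h a\<bar> \<le> C a * dist u a powr \<alpha>"
      using rC[of u a a] a r by simp
    also have "\<dots> \<le> \<bar>C a\<bar> * r a powr \<alpha>"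
      using a \<open>0 < \<alpha>\<close> r[of a] by (intro mult_mono powr_mono2) (auto simp: dist_commute)
    finally have "\<bar>h u\<bar> \<le> \<bar>h a\<bar> + \<bar>C a\<bar> * r a powr \<alpha>"
      by simp
    also have "\<dots> \<le> B"
      unfolding B_def using a D by (intro member_le_sum) auto
    finally show ?thesis .
  qed
  show ?thesis
  proof (intro exI[of _ "L + 2 * B / \<delta> powr \<alpha>"] conjI ballI)
    show "0 \<le> L + 2 * B / \<delta> powr \<alpha>"
      using \<open>0 \<le> L\<close> \<open>0 \<le> B\<close> by simp
    fix u v assume uv: "u \<in> K" "v \<in> K"
    show "\<bar>h u - h v\<bar> \<le> (L + 2 * B / \<delta> powr \<alpha>) * dist u v powr \<alpha>"
    proof (cases "dist u v < \<delta>")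
      case True
      have "diameter {u, v} \<le> dist u v"
        by (auto simp: diameter_def dist_commute intro!: cSup_least)
      with True \<delta>[of "{u, v}"] uv obtain a where a: "a \<in> D" "u \<in> ball a (r a)" "v \<in> ball a (r a)"
        by auto
      have "C a \<le> L"
        unfolding L_def using a D member_le_sum[of a D "\<lambda>a. \<bar>C a\<bar>"] by auto
      have "\<bar>h u - h v\<bar> \<le> C a * dist u v powr \<alpha>"
        using rC a by blast
      also have "\<dots> \<le> (L + 2 * B / \<delta> powr \<alpha>) * dist u v powr \<alpha>"
        using \<open>C a \<le> L\<close> \<open>0 \<le> B\<close> by (intro mult_right_mono add_increasing2) auto
      finally show ?thesis .
    next
      case False
      have "\<bar>h u - h v\<bar> \<le> 2 * B"
        using bound[OF uv(1)] bound[OF uv(2)] by linarith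
      also have "\<dots> = 2 * B / \<delta> powr \<alpha> * \<delta> powr \<alpha>"
        using \<open>0 < \<delta>\<close> by simp
      also have "\<dots> \<le> (L + 2 * B / \<delta> powr \<alpha>) * dist u v powr \<alpha>"
        using False \<open>0 < \<delta>\<close> \<open>0 < \<alpha>\<close> \<open>0 \<le> L\<close> \<open>0 \<le> B\<close>
        by (intro mult_mono powr_mono2) auto
      finally show ?thesis .
    qed
  qed
qed auto

lemma norm_matrix_le_l1: "norm A \<le> (\<Sum>i\<in>UNIV. \<Sum>j\<in>UNIV. \<bar>A $ i $ j\<bar>)" for A :: "real^'d^'n"
proof -
  have "norm A \<le> (\<Sum>i\<in>UNIV. norm (A $ i))"
    unfolding norm_vec_def[of A] by (rule L2_set_le_sum) simp
  also have "\<dots> \<le> (\<Sum>i\<in>UNIV. \<Sum>j\<in>UNIV. \<bar>A $ i $ j\<bar>)"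
    by (intro sum_mono norm_le_l1_cart)
  finally show ?thesis .
qed

lemma hoelder_matrix_on_cball:
  fixes f :: "'n::finite \<Rightarrow> 'd::finite \<Rightarrow> real^'n \<Rightarrow> real"
  assumes f: "\<And>i j. locally_hoelder \<alpha> (f i j)" and "0 < \<alpha>"
  shows "\<exists>H\<ge>0. \<forall>u\<in>cball 0 R. \<forall>v\<in>cball 0 R.
    norm ((\<chi> i j. f i j u) - (\<chi> i j. f i j v)) \<le> H * norm (u - v) powr \<alpha>"
proof -
  have "\<forall>i j. \<exists>H\<ge>0. \<forall>u\<in>cball 0 R. \<forall>v\<in>cball 0 R. \<bar>f i j u - f i j v\<bar> \<le> H * dist u v powr \<alpha>"
    using f \<open>0 < \<alpha>\<close> by (intro allI locally_hoelder_on_compact compact_cball)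
  then obtain H where H0: "\<And>i j. 0 \<le> H i j"
    and H: "\<And>i j u v. u \<in> cball 0 R \<Longrightarrow> v \<in> cball 0 R \<Longrightarrow> \<bar>f i j u - f i j v\<bar> \<le> H i j * dist u v powr \<alpha>"
    by metis
  show ?thesis
  proof (intro exI[of _ "\<Sum>i\<in>UNIV. \<Sum>j\<in>UNIV. H i j"] conjI ballI)
    show "0 \<le> (\<Sum>i\<in>UNIV. \<Sum>j\<in>UNIV. H i j)"
      using H0 by (intro sum_nonneg) auto
    fix u v :: "real^'n" assume uv: "u \<in> cball 0 R" "v \<in> cball 0 R"
    have "norm ((\<chi> i j. f i j u) - (\<chi> i j. f i j v)) \<le> (\<Sum>i\<in>UNIV. \<Sum>j\<in>UNIV. \<bar>f i j u - f i j v\<bar>)"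
      using norm_matrix_le_l1[of "(\<chi> i j. f i j u) - (\<chi> i j. f i j v)"] by simp
    also have "\<dots> \<le> (\<Sum>i\<in>UNIV. \<Sum>j\<in>UNIV. H i j * norm (u - v) powr \<alpha>)"
      using H[OF uv] by (intro sum_mono) (auto simp: dist_norm)
    finally show "norm ((\<chi> i j. f i j u) - (\<chi> i j. f i j v))
        \<le> (\<Sum>i\<in>UNIV. \<Sum>j\<in>UNIV. H i j) * norm (u - v) powr \<alpha>"
      by (simp add: sum_distrib_right)
  qed
qed

subsection \<open>Concatenation and blow-up\<close>

text \<open>Hoelder constants are required only on balls, so \<open>g\<close> may be unbounded and
  solutions may explode. \<open>p_less\<close> says that the remainder exponent \<open>q\<close>
  below exceeds 1.\<close>

locale hoelder_driven_equation =
  fixes p \<alpha> T :: real and x :: "real \<Rightarrow> real^'d" and \<omega> :: "real \<Rightarrow> real"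
    and g :: "real^'n \<Rightarrow> real^'d^'n"
  assumes p: "1 \<le> p" and \<alpha>: "0 < \<alpha>" and p_less: "p < 1 + \<alpha>"
    and \<omega>_mono: "mono_on {0..T} \<omega>" and \<omega>_cont: "continuous_on {0..T} \<omega>"
    and x: "\<And>s t. 0 \<le> s \<Longrightarrow> s \<le> t \<Longrightarrow> t \<le> T \<Longrightarrow> norm (x t - x s) \<le> (\<omega> t - \<omega> s) powr (1 / p)"
    and g: "\<And>R. \<exists>H\<ge>0. \<forall>u\<in>cball 0 R. \<forall>v\<in>cball 0 R. norm (g u - g v) \<le> H * norm (u - v) powr \<alpha>"
begin

abbreviation q :: real where "q \<equiv> (1 + \<alpha>) / p"

section \<open>Local solutions with a step size uniform over bounded starting points\<close>

lemma \<omega>_le: "0 \<le> s \<Longrightarrow> s \<le> t \<Longrightarrow> t \<le> T \<Longrightarrow> \<omega> s \<le> \<omega> t"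
  by (rule monotone_onD[OF \<omega>_mono]) auto

text \<open>Since \<open>q > 1\<close>, the factor \<open>2 powr (1 - q)\<close> is below 1 and the
  inequality for \<open>C\<close> is solvable. \<open>W\<close> is then small in terms of
  \<open>C\<close>, \<open>M\<close> and the exponents, so neither depends on the path or the
  starting time.\<close>

lemma small_control:
  assumes "0 \<le> M" "0 \<le> H"
  shows "\<exists>C W. 0 \<le> C \<and> 0 < W \<and> 2 powr (1 - q) * C + 2 * (H * (M + 1) powr \<alpha>) \<le> C
    \<and> C * W powr (\<alpha> / p) \<le> 1 \<and> (M + 1) * W powr (1 / p) \<le> 1"
proof -
  define r :: real where "r = 2 powr (1 - q)"
  have r: "r < 1"
    using p p_less by (auto simp: r_def powr_less_one)
  \<comment> \<open>The fixed point of
    \<open>c = r * c + 2 * (H * (M + 1) powr \<alpha>)\<close>.\<close>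
  define C where "C = 2 * (H * (M + 1) powr \<alpha>) / (1 - r)"
  \<comment> \<open>The outer exponents invert \<open>\<alpha> / p\<close> and \<open>1 / p\<close>;
    \<open>C + 1\<close> in place of \<open>C\<close> keeps \<open>W\<close> positive when
    \<open>C = 0\<close>.\<close>
  define W where "W = min ((1 / (C + 1)) powr (p / \<alpha>)) ((1 / (M + 1)) powr p)"
  have C: "0 \<le> C"
    using r assms by (auto simp: C_def)
  have "(1 - r) * C = 2 * (H * (M + 1) powr \<alpha>)"
    using r by (simp add: C_def)
  then have "r * C + 2 * (H * (M + 1) powr \<alpha>) \<le> C"
    by (simp add: algebra_simps)
  moreover have "0 < W"
    using C assms by (auto simp: W_def)
  moreover have "C * W powr (\<alpha> / p) \<le> 1"
  proof -
    have "W powr (\<alpha> / p) \<le> ((1 / (C + 1)) powr (p / \<alpha>)) powr (\<alpha> / p)"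
      using \<open>0 < W\<close> p \<alpha> by (intro powr_mono2) (auto simp: W_def)
    also have "\<dots> = 1 / (C + 1)"
      using p \<alpha> C by (simp add: powr_powr)
    finally have "C * W powr (\<alpha> / p) \<le> C * (1 / (C + 1))"
      using C by (rule mult_left_mono)
    also have "\<dots> \<le> 1"
      using C by (simp add: field_simps)
    finally show ?thesis .
  qed
  moreover have "(M + 1) * W powr (1 / p) \<le> 1"
  proof -
    have "W powr (1 / p) \<le> ((1 / (M + 1)) powr p) powr (1 / p)"
      using \<open>0 < W\<close> p by (intro powr_mono2) (auto simp: W_def)
    also have "\<dots> = 1 / (M + 1)"
      using p assms by (simp add: powr_powr)
    finally have "(M + 1) * W powr (1 / p) \<le> (M + 1) * (1 / (M + 1))"
      using assms by (intro mult_left_mono) auto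
    then show ?thesis
      using assms by simp
  qed
  ultimately show ?thesis
    using C unfolding r_def by blast
qed

text \<open>Precomposing with the projection onto the ball of radius \<open>R + 1\<close> makes the
  coefficient globally bounded and Hoelder with the same constant, as the projection is 1-Lipschitz.
  A solution moving at most 1 from a start of norm at most \<open>R\<close> never sees the change.
  That \<open>W\<close> depends on the start only through \<open>R\<close> drives the blow-up
  argument.\<close>

lemma local_solution_uniform:
  assumes "0 \<le> R"
  shows "\<exists>W>0. \<forall>a b y0. 0 \<le> a \<and> a \<le> b \<and> b \<le> T \<and> \<omega> b - \<omega> a \<le> W \<and> norm y0 \<le> R \<longrightarrow>
    (\<exists>y. y a = y0 \<and> (\<forall>s. norm (y s - y0) \<le> 1) \<and> davie_solution g x \<omega> q a b y)"
proof -
  define B :: "(real^'n) set" where "B = cball 0 (R + 1)"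
  define g' where "g' = (\<lambda>u. g (closest_point B u))"
  have B: "convex B" "closed B" "B \<noteq> {}"
    using assms by (auto simp: B_def)
  obtain H where H: "0 \<le> H" "\<And>u v. u \<in> B \<Longrightarrow> v \<in> B \<Longrightarrow> norm (g u - g v) \<le> H * norm (u - v) powr \<alpha>"
    using g[of "R + 1"] unfolding B_def by blast
  define M where "M = norm (g 0) + H * (R + 1) powr \<alpha>"
  have cp: "closest_point B u \<in> B" for u
    using B by (intro closest_point_in_set) auto
  have H': "norm (g' u - g' v) \<le> H * norm (u - v) powr \<alpha>" for u v
  proof -
    have "norm (g' u - g' v) \<le> H * norm (closest_point B u - closest_point B v) powr \<alpha>"
      unfolding g'_def by (intro H cp)
    also have "\<dots> \<le> H * norm (u - v) powr \<alpha>"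
      using closest_point_lipschitz[OF B, of u v] H \<alpha>
      by (intro mult_left_mono powr_mono2) (auto simp: dist_norm)
    finally show ?thesis .
  qed
  have M: "norm (g' u) \<le> M" for u
  proof -
    have "norm (g' u - g 0) \<le> H * norm (closest_point B u - 0) powr \<alpha>"
      unfolding g'_def using assms by (intro H cp) (auto simp: B_def)
    also have "\<dots> \<le> H * (R + 1) powr \<alpha>"
      using cp[of u] H \<alpha> by (intro mult_left_mono powr_mono2) (auto simp: B_def)
    finally show ?thesis
      using norm_triangle_ineq2[of "g' u" "g 0"] by (simp add: M_def)
  qed
  have "0 \<le> M"
    using H by (simp add: M_def)
  obtain C W where C: "0 \<le> C" and W: "0 < W"
    and CW: "2 powr (1 - q) * C + 2 * (H * (M + 1) powr \<alpha>) \<le> C"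
      "C * W powr (\<alpha> / p) \<le> 1" "(M + 1) * W powr (1 / p) \<le> 1"
    using small_control[OF \<open>0 \<le> M\<close> \<open>0 \<le> H\<close>] by blast
  have "\<exists>y. y a = y0 \<and> (\<forall>s. norm (y s - y0) \<le> 1) \<and> davie_solution g x \<omega> q a b y"
    if "0 \<le> a" "a \<le> b" "b \<le> T" "\<omega> b - \<omega> a \<le> W" "norm y0 \<le> R" for a b y0
  proof -
    have "\<exists>y. y a = y0 \<and> (\<forall>s. norm (y s - y0) \<le> 1) \<and> davie_solution g' x \<omega> q a b y"
    proof (rule local_solution[where W = W and M = M and H = H and C = C])
      show "mono_on {a..b} \<omega>"
        using \<omega>_mono that by (auto intro: mono_on_subset)
      show "norm (x t - x s) \<le> (\<omega> t - \<omega> s) powr (1 / p)" if "a \<le> s" "s \<le> t" "t \<le> b" for s t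
        using that \<open>0 \<le> a\<close> \<open>b \<le> T\<close> by (intro x) auto
    qed (fact \<alpha> p M H' H C CW that)+
    then obtain y where y: "y a = y0" "\<And>s. norm (y s - y0) \<le> 1" "davie_solution g' x \<omega> q a b y"
      by blast
    have "g' (y s) = g (y s)" for s
    proof -
      have "norm (y s) \<le> R + 1"
        using y(2)[of s] that norm_triangle_ineq[of "y s - y0" y0] by simp
      then show ?thesis
        by (simp add: g'_def B_def closest_point_self)
    qed
    then have "davie_solution g x \<omega> q a b y"
      using y(3) by (simp add: davie_solution_def)
    with y show ?thesis
      by blast
  qed
  then show ?thesis
    using W by blast
qed

section \<open>Regularity and concatenation of solutions\<close>

lemma solution_regularity:
  assumes y: "davie_solution g x \<omega> q a b y" and ab: "0 \<le> a" "a \<le> b" "b \<le> T"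
  shows "\<exists>R K. 0 \<le> K \<and> (\<forall>s\<in>{a..b}. y s \<in> cball 0 R) \<and>
    (\<forall>s t. a \<le> s \<and> s \<le> t \<and> t \<le> b \<longrightarrow> norm (y t - y s) \<le> K * (\<omega> t - \<omega> s) powr (1 / p))"
proof -
  obtain C' where C': "\<And>s t. a \<le> s \<Longrightarrow> s \<le> t \<Longrightarrow> t \<le> b \<Longrightarrow>
      norm (y t - y s - g (y s) *v (x t - x s)) \<le> C' * (\<omega> t - \<omega> s) powr q"
    using y unfolding davie_solution_def by blast
  define C where "C = max C' 0"
  have C: "norm (y t - y s - g (y s) *v (x t - x s)) \<le> C * (\<omega> t - \<omega> s) powr q"
    if "a \<le> s" "s \<le> t" "t \<le> b" for s t
    using C'[OF that] by (rule order_trans) (auto simp: C_def intro!: mult_right_mono)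
  define W where "W = \<omega> b - \<omega> a"
  have incr: "norm (y t - y s) \<le> (M + C * W powr (\<alpha> / p)) * (\<omega> t - \<omega> s) powr (1 / p)"
    if "a \<le> s" "s \<le> t" "t \<le> b" "norm (g (y s)) \<le> M" for s t M
    using that C[of s t] x[of s t] ab \<alpha> p \<omega>_le[of s t] \<omega>_le[of a s] \<omega>_le[of t b]
    by (intro increment_bound[where A = "g (y s)" and w = "x t - x s" and C = C and W = W and \<alpha> = \<alpha>
          and M = M]) (auto simp: C_def W_def)
  \<comment> \<open>First stage: with the base point fixed at \<open>a\<close>, only
    \<open>g (y a)\<close> enters, and this already bounds the whole path.\<close>
  define M0 where "M0 = norm (g (y a)) + C * W powr (\<alpha> / p)"
  define R where "R = norm (y a) + M0 * W powr (1 / p)"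
  have M0: "0 \<le> M0"
    by (simp add: M0_def C_def)
  have R: "y s \<in> cball 0 R" if "s \<in> {a..b}" for s
  proof -
    have "norm (y s - y a) \<le> M0 * (\<omega> s - \<omega> a) powr (1 / p)"
      unfolding M0_def using that by (intro incr) auto
    also have "\<dots> \<le> M0 * W powr (1 / p)"
      using that M0 p ab \<omega>_le[of a s] \<omega>_le[of s b] by (intro mult_left_mono powr_mono2) (auto simp: W_def)
    finally show ?thesis
      using norm_triangle_ineq2[of "y s" "y a"] by (simp add: R_def)
  qed
  obtain H where H: "0 \<le> H" "\<And>u v. u \<in> cball 0 R \<Longrightarrow> v \<in> cball 0 R \<Longrightarrow> norm (g u - g v) \<le> H * norm (u - v) powr \<alpha>"
    using g[of R] by blast
  \<comment> \<open>Second stage: inside the ball just found, the Hoelder bound controls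
    \<open>g (y s)\<close> for every base point; \<open>2 * R\<close> bounds the distance of two
    values of \<open>y\<close>.\<close>
  define M where "M = norm (g (y a)) + H * (2 * R) powr \<alpha>"
  have M: "norm (g (y s)) \<le> M" if "s \<in> {a..b}" for s
  proof -
    have "norm (g (y s) - g (y a)) \<le> H * norm (y s - y a) powr \<alpha>"
      using that ab by (intro H R) auto
    also have "\<dots> \<le> H * (2 * R) powr \<alpha>"
    proof -
      have "norm (y s - y a) \<le> 2 * R"
        using R[of s] R[of a] that ab norm_triangle_ineq4[of "y s" "y a"] by auto
      then show ?thesis
        using H \<alpha> by (intro mult_left_mono powr_mono2) auto
    qed
    finally show ?thesis
      using norm_triangle_ineq2[of "g (y s)" "g (y a)"] by (simp add: M_def)
  qed
  show ?thesis
  proof (intro exI conjI allI impI ballI)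
    show "0 \<le> M + C * W powr (\<alpha> / p)"
      using H by (simp add: M_def C_def)
    show "norm (y t - y s) \<le> (M + C * W powr (\<alpha> / p)) * (\<omega> t - \<omega> s) powr (1 / p)"
      if "a \<le> s \<and> s \<le> t \<and> t \<le> b" for s t
      using that by (intro incr M) auto
  qed (use R in auto)
qed

text \<open>Only pairs straddling \<open>b\<close> need work. There the base point moves from
  \<open>s\<close> to \<open>b\<close>, and the resulting cross term has the right order because
  \<open>y1\<close> has increments of order \<open>1 / p\<close> in the control.\<close>

lemma solution_concat:
  assumes y1: "davie_solution g x \<omega> q a b y1" and y2: "davie_solution g x \<omega> q b c y2"
    and abc: "0 \<le> a" "a \<le> b" "b \<le> c" "c \<le> T" and eq: "y1 b = y2 b"
  shows "davie_solution g x \<omega> q a c (\<lambda>t. if t \<le> b then y1 t else y2 t)"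
proof -
  obtain C1 where C1: "\<And>s t. a \<le> s \<Longrightarrow> s \<le> t \<Longrightarrow> t \<le> b \<Longrightarrow>
      norm (y1 t - y1 s - g (y1 s) *v (x t - x s)) \<le> C1 * (\<omega> t - \<omega> s) powr q"
    using y1 unfolding davie_solution_def by blast
  obtain C2 where C2: "\<And>s t. b \<le> s \<Longrightarrow> s \<le> t \<Longrightarrow> t \<le> c \<Longrightarrow>
      norm (y2 t - y2 s - g (y2 s) *v (x t - x s)) \<le> C2 * (\<omega> t - \<omega> s) powr q"
    using y2 unfolding davie_solution_def by blast
  have "b \<le> T"
    using abc by simp
  obtain R K where K: "0 \<le> K" and R: "\<And>s. s \<in> {a..b} \<Longrightarrow> y1 s \<in> cball 0 R"
    and yK: "\<And>s t. a \<le> s \<Longrightarrow> s \<le> t \<Longrightarrow> t \<le> b \<Longrightarrow> norm (y1 t - y1 s) \<le> K * (\<omega> t - \<omega> s) powr (1 / p)"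
    using solution_regularity[OF y1 abc(1,2) \<open>b \<le> T\<close>] by blast
  obtain H where H: "0 \<le> H" "\<And>u v. u \<in> cball 0 R \<Longrightarrow> v \<in> cball 0 R \<Longrightarrow> norm (g u - g v) \<le> H * norm (u - v) powr \<alpha>"
    using g[of R] by blast
  define C where "C = \<bar>C1\<bar> + \<bar>C2\<bar> + H * K powr \<alpha>"
  have powr_le: "c' * d powr q \<le> C'' * \<delta> powr q" if "c' \<le> C''" "0 \<le> C''" "0 \<le> d" "d \<le> \<delta>"
    for c' C'' d \<delta> :: real
    using that p \<alpha> by (intro mult_mono powr_mono2) auto
  have C: "C1 \<le> C" "C2 \<le> C" "0 \<le> C"
    using mult_nonneg_nonneg[OF H(1) powr_ge_zero, of K \<alpha>] unfolding C_def by linarith+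
  define y where "y t = (if t \<le> b then y1 t else y2 t)" for t
  have y_ge: "y t = y2 t" if "b \<le> t" for t
    using that eq by (auto simp: y_def)
  have "norm (y t - y s - g (y s) *v (x t - x s)) \<le> C * (\<omega> t - \<omega> s) powr q"
    if st: "a \<le> s" "s \<le> t" "t \<le> c" for s t
  proof -
    have \<delta>: "0 \<le> \<omega> t - \<omega> s"
      using st abc \<omega>_le by auto
    consider "t \<le> b" | "b \<le> s" | "s < b" "b < t"
      by linarith
    then show ?thesis
    proof cases
      case 1
      show ?thesis
        using C1[of s t] powr_le[of C1 C "\<omega> t - \<omega> s" "\<omega> t - \<omega> s"] C \<delta> st 1 by (simp add: y_def)
    next
      case 2
      show ?thesis
        using C2[of s t] powr_le[of C2 C "\<omega> t - \<omega> s" "\<omega> t - \<omega> s"] C \<delta> st 2 by (simp add: y_ge)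
    next
      case 3
      define \<delta> where "\<delta> = \<omega> t - \<omega> s"
      have \<delta>s: "0 \<le> \<omega> b - \<omega> s" "\<omega> b - \<omega> s \<le> \<delta>" "0 \<le> \<omega> t - \<omega> b" "\<omega> t - \<omega> b \<le> \<delta>"
        using 3 st abc \<omega>_le[of s b] \<omega>_le[of b t] by (auto simp: \<delta>_def)
      have J1: "norm (y1 b - y1 s - g (y1 s) *v (x b - x s)) \<le> \<bar>C1\<bar> * \<delta> powr q"
        using C1[of s b] powr_le[of C1 "\<bar>C1\<bar>" "\<omega> b - \<omega> s" \<delta>] abs_ge_self[of C1] \<delta>s 3 st by simp
      have J2: "norm (y2 t - y2 b - g (y2 b) *v (x t - x b)) \<le> \<bar>C2\<bar> * \<delta> powr q"
        using C2[of b t] powr_le[of C2 "\<bar>C2\<bar>" "\<omega> t - \<omega> b" \<delta>] abs_ge_self[of C2] \<delta>s 3 st by simp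
      have "K * (\<omega> b - \<omega> s) powr (1 / p) \<le> K * \<delta> powr (1 / p)" "(\<omega> t - \<omega> b) powr (1 / p) \<le> \<delta> powr (1 / p)"
        using K \<delta>s p by (auto intro!: mult_left_mono powr_mono2)
      then have cross: "norm ((g (y1 b) - g (y1 s)) *v (x t - x b)) \<le> H * K powr \<alpha> * \<delta> powr q"
        using H(2)[of "y1 b" "y1 s"] R[of b] R[of s] yK[of s b] x[of b t] 3 st abc \<alpha> K H(1) \<delta>s
        by (intro hoelder_cross_term) auto
      have "y t - y s - g (y s) *v (x t - x s) = (y1 b - y1 s - g (y1 s) *v (x b - x s))
          + (y2 t - y2 b - g (y2 b) *v (x t - x b)) + (g (y1 b) - g (y1 s)) *v (x t - x b)"
        using 3 eq by (simp add: y_def matrix_vector_mult_diff_distrib matrix_vector_mult_diff_rdistrib)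
      also have "norm \<dots> \<le> \<bar>C1\<bar> * \<delta> powr q + \<bar>C2\<bar> * \<delta> powr q + H * K powr \<alpha> * \<delta> powr q"
        by (intro norm_triangle_mono J1 J2 cross)
      finally show ?thesis
        by (simp add: C_def \<delta>_def algebra_simps)
    qed
  qed
  then show ?thesis
    unfolding davie_solution_def y_def by blast
qed

text \<open>A greedy step: either the rest of the interval costs at most \<open>W\<close> and
  \<open>T\<close> is reached, or continuity of the control allows exactly \<open>W\<close> to be
  spent. Closeness to \<open>y t\<close> at all later \<open>s\<close> will give blow-up along all
  times, not only along the endpoints of steps.\<close>

lemma solution_step:
  assumes W: "0 < W" "\<And>a b y0. 0 \<le> a \<Longrightarrow> a \<le> b \<Longrightarrow> b \<le> T \<Longrightarrow> \<omega> b - \<omega> a \<le> W \<Longrightarrow> norm y0 \<le> R \<Longrightarrow>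
      \<exists>y. y a = y0 \<and> (\<forall>s. norm (y s - y0) \<le> 1) \<and> davie_solution g x \<omega> q a b y"
    and y: "davie_solution g x \<omega> q 0 t y" and t: "0 \<le> t" "t \<le> T" and R: "norm (y t) \<le> R"
  shows "\<exists>t' y'. t \<le> t' \<and> t' \<le> T \<and> (\<forall>s\<le>t. y' s = y s) \<and> davie_solution g x \<omega> q 0 t' y' \<and>
    (\<forall>s\<ge>t. norm (y' s - y t) \<le> 1) \<and> (t' = T \<or> W \<le> \<omega> t' - \<omega> t)"
proof -
  obtain t' where t': "t \<le> t'" "t' \<le> T" "\<omega> t' - \<omega> t \<le> W" "t' = T \<or> W \<le> \<omega> t' - \<omega> t"
  proof (cases "\<omega> T - \<omega> t \<le> W")
    case True
    then show ?thesis
      using t by (intro that[of T]) auto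
  next
    case False
    have "continuous_on {t..T} \<omega>"
      using t by (intro continuous_on_subset[OF \<omega>_cont]) auto
    then have "\<exists>s\<ge>t. s \<le> T \<and> \<omega> s = \<omega> t + W"
      using False W t by (intro IVT') auto
    then show ?thesis
      using that by auto
  qed
  then obtain z where z: "z t = y t" "\<And>s. norm (z s - y t) \<le> 1" "davie_solution g x \<omega> q t t' z"
    using W(2)[of t t' "y t"] R t by blast
  have "davie_solution g x \<omega> q 0 t' (\<lambda>s. if s \<le> t then y s else z s)"
    using solution_concat[OF y z(3)] t t' z(1) by simp
  then show ?thesis
    using t' z by (intro exI[of _ t'] exI[of _ "\<lambda>s. if s \<le> t then y s else z s"]) auto
qed

section \<open>The maximal solution and its blow-up\<close>

lemma davie_solution_subinterval:
  "davie_solution g x \<omega> q a b y \<Longrightarrow> b' \<le> b \<Longrightarrow> davie_solution g x \<omega> q a b' y"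
  unfolding davie_solution_def by (meson order_trans)

lemma davie_solution_cong:
  assumes "davie_solution g x \<omega> q a b y" and "\<And>s. s \<le> b \<Longrightarrow> y' s = y s"
  shows "davie_solution g x \<omega> q a b y'"
  using assms unfolding davie_solution_def by (metis order_trans)

lemma maximal_solution:
  assumes "0 < T"
  shows "\<exists>\<tau> y. 0 < \<tau> \<and> \<tau> \<le> T \<and> y 0 = y0 \<and> (\<forall>t1. 0 \<le> t1 \<and> t1 < \<tau> \<longrightarrow> davie_solution g x \<omega> q 0 t1 y) \<and>
    (\<tau> < T \<longrightarrow> filterlim (\<lambda>t. norm (y t)) at_top (at_left \<tau>))"
proof -
  have "\<forall>n::nat. \<exists>W>0. \<forall>a b y0. 0 \<le> a \<and> a \<le> b \<and> b \<le> T \<and> \<omega> b - \<omega> a \<le> W \<and> norm y0 \<le> real n \<longrightarrow>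
    (\<exists>y. y a = y0 \<and> (\<forall>s. norm (y s - y0) \<le> 1) \<and> davie_solution g x \<omega> q a b y)"
    by (intro allI local_solution_uniform) auto
  then obtain W where W0: "\<And>n. 0 < W n"
    and W: "\<And>n a b y0. 0 \<le> a \<Longrightarrow> a \<le> b \<Longrightarrow> b \<le> T \<Longrightarrow> \<omega> b - \<omega> a \<le> W n \<Longrightarrow> norm y0 \<le> real n \<Longrightarrow>
      \<exists>y. y a = y0 \<and> (\<forall>s. norm (y s - y0) \<le> 1) \<and> davie_solution g x \<omega> q a b y"
    by metis
  define P where "P z \<longleftrightarrow> 0 \<le> fst z \<and> fst z \<le> T \<and> snd z 0 = y0 \<and> davie_solution g x \<omega> q 0 (fst z) (snd z)"
    for z :: "real \<times> (real \<Rightarrow> real^'n)"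
  \<comment> \<open>The index rounds the norm at the current endpoint up to an integer, so one
    countable family of step sizes serves all starting points.\<close>
  define Q where "Q z z' \<longleftrightarrow> fst z \<le> fst z' \<and> (\<forall>s\<le>fst z. snd z' s = snd z s) \<and>
      (\<forall>s\<ge>fst z. norm (snd z' s - snd z (fst z)) \<le> 1) \<and>
      (fst z' = T \<or> W (nat \<lceil>norm (snd z (fst z))\<rceil>) \<le> \<omega> (fst z') - \<omega> (fst z))"
    for z z' :: "real \<times> (real \<Rightarrow> real^'n)"
  have "\<exists>z. \<forall>k::nat. P (z k) \<and> Q (z k) (z (Suc k))"
  proof (rule dependent_nat_choice)
    have "davie_solution g x \<omega> q 0 0 (\<lambda>_. y0)"
      unfolding davie_solution_def
    proof (intro exI allI impI)
      fix s t :: real assume "0 \<le> s \<and> s \<le> t \<and> t \<le> 0"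
      then have "s = t"
        by simp
      then show "norm (y0 - y0 - g y0 *v (x t - x s)) \<le> 0 * (\<omega> t - \<omega> s) powr q"
        by simp
    qed
    then have "P (0, \<lambda>_. y0)"
      using \<open>0 < T\<close> by (simp add: P_def)
    then show "\<exists>z. P z" ..
  next
    fix z :: "real \<times> (real \<Rightarrow> real^'n)" and k :: nat
    assume z: "P z"
    have "\<exists>t' y'. fst z \<le> t' \<and> t' \<le> T \<and> (\<forall>s\<le>fst z. y' s = snd z s) \<and> davie_solution g x \<omega> q 0 t' y' \<and>
        (\<forall>s\<ge>fst z. norm (y' s - snd z (fst z)) \<le> 1) \<and>
        (t' = T \<or> W (nat \<lceil>norm (snd z (fst z))\<rceil>) \<le> \<omega> t' - \<omega> (fst z))"
      by (rule solution_step[OF W0 W, where R = "real (nat \<lceil>norm (snd z (fst z))\<rceil>)"])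
        (use z in \<open>auto simp: P_def of_nat_ceiling\<close>)
    then obtain t' y' where "fst z \<le> t'" "t' \<le> T" "\<forall>s\<le>fst z. y' s = snd z s" "davie_solution g x \<omega> q 0 t' y'"
        "\<forall>s\<ge>fst z. norm (y' s - snd z (fst z)) \<le> 1"
        "t' = T \<or> W (nat \<lceil>norm (snd z (fst z))\<rceil>) \<le> \<omega> t' - \<omega> (fst z)"
      by blast
    then have "P (t', y') \<and> Q z (t', y')"
      using z by (auto simp: P_def Q_def)
    then show "\<exists>z'. P z' \<and> Q z z'" ..
  qed
  then obtain z where z: "\<And>k. P (z k)" "\<And>k. Q (z k) (z (Suc k))"
    by blast
  define t where "t k = fst (z k)" for k
  define Y where "Y k = snd (z k)" for k
  have t: "0 \<le> t k" "t k \<le> T" and Y0: "Y k 0 = y0" and Ysol: "davie_solution g x \<omega> q 0 (t k) (Y k)" for k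
    using z(1)[of k] by (auto simp: P_def t_def Y_def)
  have t_Suc: "t k \<le> t (Suc k)" and Y_Suc: "\<And>s. s \<le> t k \<Longrightarrow> Y (Suc k) s = Y k s"
    and Y_near: "\<And>s. t k \<le> s \<Longrightarrow> norm (Y (Suc k) s - Y k (t k)) \<le> 1"
    and t_step: "t (Suc k) = T \<or> W (nat \<lceil>norm (Y k (t k))\<rceil>) \<le> \<omega> (t (Suc k)) - \<omega> (t k)" for k
    using z(2)[of k] by (auto simp: Q_def t_def Y_def)
  have t_mono: "t j \<le> t k" if "j \<le> k" for j k
    using that t_Suc by (rule lift_Suc_mono_le[rotated])
  have Y_eq: "Y k s = Y j s" if "j \<le> k" "s \<le> t j" for j k s
    using that
  proof (induction k rule: dec_induct)
    case (step k)
    then show ?case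
      using Y_Suc[of s k] t_mono[of j k] by auto
  qed simp
  show ?thesis
  proof (cases "\<exists>k. t k = T")
    \<comment> \<open>\<open>T\<close> is reached after finitely many steps; then
      \<open>\<tau> = T\<close> and no blow-up is claimed.\<close>
    case True
    then obtain k where "t k = T" ..
    then show ?thesis
      using \<open>0 < T\<close> Y0[of k] Ysol[of k]
      by (intro exI[of _ T] exI[of _ "Y k"]) (auto intro: davie_solution_subinterval)
  next
    case False
    then have t_less: "t k < T" for k
      using t(2)[of k] by (simp add: order_less_le)
    have jump: "W (nat \<lceil>norm (Y k (t k))\<rceil>) \<le> \<omega> (t (Suc k)) - \<omega> (t k)" for k
      using t_step[of k] t_less[of "Suc k"] by auto
    define \<tau> where "\<tau> = (SUP k. t k)"
    have bdd: "bdd_above (range t)"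
      using t by (intro bdd_aboveI[of _ T]) auto
    have t_le_\<tau>: "t k \<le> \<tau>" for k
      unfolding \<tau>_def by (intro cSUP_upper bdd) auto
    have "t 0 \<noteq> t (Suc 0)"
      using jump[of 0] W0 by (metis diff_self linorder_not_le)
    then have "0 < \<tau>"
      using t(1)[of 0] t_Suc[of 0] t_le_\<tau>[of "Suc 0"] by linarith
    have "\<tau> \<le> T"
      unfolding \<tau>_def using t by (intro cSUP_least) auto
    have reach: "\<exists>k. s < t k" if "s < \<tau>" for s
      using that bdd by (simp add: \<tau>_def less_cSUP_iff)
    \<comment> \<open>Stages agree where they overlap, so the first stage covering \<open>s\<close>
      represents all later ones.\<close>
    define y where "y s = Y (LEAST k. s \<le> t k) s" for s
    have y_eq: "y s = Y k s" if "s \<le> t k" for s k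
      unfolding y_def using that
      by (intro Y_eq[symmetric] Least_le LeastI[of "\<lambda>k. s \<le> t k"])
    have "davie_solution g x \<omega> q 0 t1 y" if t1: "t1 < \<tau>" for t1
    proof -
      obtain k where "t1 < t k"
        using reach t1 by blast
      then show ?thesis
        using Ysol[of k] y_eq davie_solution_cong davie_solution_subinterval by (meson less_imp_le)
    qed
    moreover have "filterlim (\<lambda>s. norm (y s)) at_top (at_left \<tau>)"
    proof -
      \<comment> \<open>The control at the endpoints is increasing and bounded by
        \<open>\<omega> T\<close>, hence convergent, so the amounts spent per step tend to
        0.\<close>
      have "incseq (\<lambda>k. \<omega> (t k))"
        using t t_Suc by (intro incseq_SucI \<omega>_le) auto
      moreover have "\<omega> (t k) \<le> \<omega> T" for k
        using t by (intro \<omega>_le) auto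
      ultimately obtain l where "(\<lambda>k. \<omega> (t k)) \<longlonglongrightarrow> l"
        using incseq_convergent by blast
      then have "(\<lambda>k. \<omega> (t (Suc k)) - \<omega> (t k)) \<longlonglongrightarrow> l - l"
        by (intro tendsto_diff LIMSEQ_Suc)
      then have jump0: "(\<lambda>k. \<omega> (t (Suc k)) - \<omega> (t k)) \<longlonglongrightarrow> 0"
        by simp
      have large: "\<forall>\<^sub>F k in sequentially. real n < norm (Y k (t k))" for n :: nat
      proof -
        \<comment> \<open>A step starting at norm at most \<open>n\<close> spends at least
          \<open>w\<close>, the least of finitely many positive step sizes. Spending less than
          \<open>w\<close> therefore forces the norm above \<open>n\<close>.\<close>
        define w where "w = Min (W ` {..n})"
        have "0 < w"
          using W0 by (simp add: w_def)
        have "real n < norm (Y k (t k))" if "\<omega> (t (Suc k)) - \<omega> (t k) < w" for k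
        proof (rule ccontr)
          assume "\<not> real n < norm (Y k (t k))"
          then have "nat \<lceil>norm (Y k (t k))\<rceil> \<le> n"
            by (simp add: ceiling_le_iff nat_le_iff)
          then have "w \<le> W (nat \<lceil>norm (Y k (t k))\<rceil>)"
            unfolding w_def by (intro Min_le) auto
          then show False
            using jump[of k] that by simp
        qed
        then show ?thesis
          by (rule eventually_mono[OF order_tendstoD(2)[OF jump0 \<open>0 < w\<close>]])
      qed
      show ?thesis
        unfolding filterlim_at_top
      proof
        fix Z :: real
        \<comment> \<open>The extra 1 pays for the distance between \<open>y s\<close> and the
          endpoint value of the preceding stage.\<close>
        obtain n :: nat where n: "Z + 1 \<le> real n"
          using real_arch_simple by blast
        obtain K where K: "\<And>k. K \<le> k \<Longrightarrow> real n < norm (Y k (t k))"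
          using large[of n] unfolding eventually_sequentially by blast
        have "Z \<le> norm (y s)" if s: "t K < s" "s < \<tau>" for s
        proof -
          \<comment> \<open>The first stage reaching strictly past \<open>s\<close>: minimality
            gives \<open>t k \<le> s\<close> for its predecessor \<open>k\<close>, so
            \<open>Y_near\<close> compares \<open>y s\<close> with \<open>Y k (t k)\<close>.\<close>
          define m where "m = (LEAST k. s < t k)"
          have m: "s < t m"
            unfolding m_def using reach[OF s(2)] by (rule LeastI_ex)
          then have "K < m"
            using s t_mono[of m K] by (meson linorder_not_less order.strict_trans2 order_less_asym)
          then obtain k where k: "m = Suc k" "K \<le> k"
            by (cases m) auto
          then have "t k \<le> s"
            using not_less_Least[of k "\<lambda>k. s < t k"] by (simp add: m_def)
          have "norm (Y k (t k)) - norm (y s) \<le> norm (y s - Y k (t k))"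
            by (metis norm_minus_commute norm_triangle_ineq2)
          also have "\<dots> \<le> 1"
            using Y_near[OF \<open>t k \<le> s\<close>] y_eq[of s m] m k by simp
          finally show ?thesis
            using K[OF k(2)] n by simp
        qed
        moreover have "t K < \<tau>"
        proof -
          have "t K \<noteq> t (Suc K)"
            using jump[of K] W0 by (metis diff_self linorder_not_le)
          then show ?thesis
            using t_Suc[of K] t_le_\<tau>[of "Suc K"] by linarith
        qed
        ultimately show "\<forall>\<^sub>F s in at_left \<tau>. Z \<le> norm (y s)"
          by (auto simp: eventually_at_left_field)
      qed
    qed
    moreover have "y 0 = y0"
      using y_eq[of 0 0] t Y0 by simp
    ultimately show ?thesis
      using \<open>0 < \<tau>\<close> \<open>\<tau> \<le> T\<close> by blast
  qed
qed

end

section \<open>Translation into the required notion of solution\<close>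

lemma davie_solution_imp_solution_on:
  fixes f :: "'n::finite \<Rightarrow> 'd::finite \<Rightarrow> real^'n \<Rightarrow> real"
  assumes y: "davie_solution (\<lambda>u. \<chi> i j. f i j u) x \<omega> q 0 t1 y" "y 0 = y0" and "1 < q"
    and \<omega>: "continuous_on {0..t1} \<omega>" "mono_on {0..t1} \<omega>"
  shows "solution_on f x y0 t1 y"
proof -
  obtain C where C: "\<And>s t. 0 \<le> s \<Longrightarrow> s \<le> t \<Longrightarrow> t \<le> t1 \<Longrightarrow>
      norm (y t - y s - (\<chi> i j. f i j (y s)) *v (x t - x s)) \<le> C * (\<omega> t - \<omega> s) powr q"
    using y unfolding davie_solution_def by blast
  \<comment> \<open>The absolute value makes \<open>\<theta>\<close> nonnegative whatever the sign
    of \<open>C\<close>; \<open>0 powr q = 0\<close> gives \<open>\<theta> 0 = 0\<close>, and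
    \<open>1 < q\<close> gives the little-o condition.\<close>
  define \<theta> where "\<theta> \<delta> = \<bar>C\<bar> * \<delta> powr q" for \<delta> :: real
  have "\<theta> \<in> o[at_right 0](\<lambda>\<delta>. \<delta>)"
  proof (rule smalloI_tendsto)
    have "((\<lambda>\<delta>. \<bar>C\<bar> * \<delta> powr (q - 1)) \<longlongrightarrow> 0) (at_right 0)"
      using \<open>1 < q\<close>
      by (intro tendsto_mult_right_zero tendsto_zero_powrI[where b = "q - 1"])
        (auto intro: tendsto_ident_at simp: eventually_at_right_less eventually_mono[OF eventually_at_right_less])
    then show "((\<lambda>\<delta>. \<theta> \<delta> / \<delta>) \<longlongrightarrow> 0) (at_right 0)"
      by (rule Lim_transform_eventually)
        (auto simp: \<theta>_def powr_diff intro: eventually_mono[OF eventually_at_right_less[of 0]])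
    show "\<forall>\<^sub>F \<delta> in at_right 0. \<delta> \<noteq> (0::real)"
      by (auto intro: eventually_mono[OF eventually_at_right_less[of 0]])
  qed
  moreover have "\<bar>y t $ i - y s $ i - (\<Sum>j\<in>UNIV. f i j (y s) * (x t $ j - x s $ j))\<bar> \<le> \<theta> (\<omega> t - \<omega> s)"
    if "0 \<le> s \<and> s < t \<and> t \<le> t1" for i s t
  proof -
    have "\<bar>y t $ i - y s $ i - (\<Sum>j\<in>UNIV. f i j (y s) * (x t $ j - x s $ j))\<bar>
        = \<bar>(y t - y s - (\<chi> i j. f i j (y s)) *v (x t - x s)) $ i\<bar>"
      by (simp add: matrix_vector_mult_def)
    also have "\<dots> \<le> norm (y t - y s - (\<chi> i j. f i j (y s)) *v (x t - x s))"
      by (rule component_le_norm_cart)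
    also have "\<dots> \<le> C * (\<omega> t - \<omega> s) powr q"
      using that by (intro C) auto
    also have "\<dots> \<le> \<theta> (\<omega> t - \<omega> s)"
      by (auto simp: \<theta>_def intro: mult_right_mono)
    finally show ?thesis .
  qed
  ultimately show ?thesis
    unfolding solution_on_def using y \<omega>
    by (intro conjI exI[of _ \<omega>] exI[of _ \<theta>]) (auto simp: \<theta>_def)
qed

theorem theorem2p2:
  fixes p \<gamma> T :: real
    and x :: "real \<Rightarrow> real^'d"
    and f :: "'n \<Rightarrow> 'd \<Rightarrow> real^'n \<Rightarrow> real"
    and y0 :: "real^'n"
  assumes "1 \<le> p" and "p < \<gamma>" and "\<gamma> \<le> 2" and "0 < T"
    and "continuous_on {0..T} x" and "finite_p_variation p T x"
    and "f \<in> C_class (\<gamma> - 1)"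
  shows "\<exists>\<tau> y. 0 < \<tau> \<and> \<tau> \<le> T \<and> solution_before f x y0 \<tau> y \<and>
           (\<tau> < T \<longrightarrow> filterlim (\<lambda>t. norm (y t)) at_top (at_left \<tau>))"
proof -
  define \<alpha> where "\<alpha> = \<gamma> - 1"
  obtain N \<beta> where N: "\<gamma> - 1 = real N + \<beta>" "0 < \<beta>" "\<And>i j. hoelder_derivs N \<beta> (f i j)"
    using \<open>f \<in> C_class (\<gamma> - 1)\<close> unfolding C_class_def by auto
  \<comment> \<open>\<open>real N + \<beta> \<le> 1\<close> with \<open>0 < \<beta>\<close> rules
    out derivatives, so \<open>\<beta> = \<alpha>\<close> and only the Hoelder condition on
    \<open>f\<close> itself remains. This covers the Lipschitz case
    \<open>\<gamma> = 2\<close>.\<close>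
  then have "N = 0"
    using \<open>\<gamma> \<le> 2\<close> by linarith
  then have f: "locally_hoelder \<alpha> (f i j)" for i j
    using N(1) N(3)[of i j] by (simp add: \<alpha>_def)
  obtain \<omega> where \<omega>: "continuous_on {0..T} \<omega>" "mono_on {0..T} \<omega>"
    and x: "\<And>s t. 0 \<le> s \<Longrightarrow> s \<le> t \<Longrightarrow> t \<le> T \<Longrightarrow> norm (x t - x s) powr p \<le> \<omega> t - \<omega> s"
    using \<open>finite_p_variation p T x\<close> unfolding finite_p_variation_def by blast
  interpret hoelder_driven_equation p \<alpha> T x \<omega> "\<lambda>u. \<chi> i j. f i j u"
  proof
    show "norm (x t - x s) \<le> (\<omega> t - \<omega> s) powr (1 / p)" if "0 \<le> s" "s \<le> t" "t \<le> T" for s t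
    proof -
      have "norm (x t - x s) = (norm (x t - x s) powr p) powr (1 / p)"
        using \<open>1 \<le> p\<close> by (simp add: powr_powr)
      also have "\<dots> \<le> (\<omega> t - \<omega> s) powr (1 / p)"
        using x[OF that] \<open>1 \<le> p\<close> by (intro powr_mono2) auto
      finally show ?thesis .
    qed
    show "\<exists>H\<ge>0. \<forall>u\<in>cball 0 R. \<forall>v\<in>cball 0 R.
        norm ((\<chi> i j. f i j u) - (\<chi> i j. f i j v)) \<le> H * norm (u - v) powr \<alpha>" for R
      using assms f by (intro hoelder_matrix_on_cball) (auto simp: \<alpha>_def)
  qed (use assms \<omega> in \<open>auto simp: \<alpha>_def\<close>)
  obtain \<tau> y where \<tau>: "0 < \<tau>" "\<tau> \<le> T" and y0: "y 0 = y0"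
    and y: "\<And>t1. 0 \<le> t1 \<Longrightarrow> t1 < \<tau> \<Longrightarrow> davie_solution (\<lambda>u. \<chi> i j. f i j u) x \<omega> q 0 t1 y"
    and blowup: "\<tau> < T \<longrightarrow> filterlim (\<lambda>t. norm (y t)) at_top (at_left \<tau>)"
    using maximal_solution[OF \<open>0 < T\<close>, of y0] by blast
  have "1 < q"
    using p p_less by simp
  have "solution_before f x y0 \<tau> y"
    unfolding solution_before_def
  proof (intro allI impI)
    fix t1 assume t1: "0 \<le> t1 \<and> t1 < \<tau>"
    then have "{0..t1} \<subseteq> {0..T}"
      using \<tau> by auto
    then show "solution_on f x y0 t1 y"
      using davie_solution_imp_solution_on[OF y y0 \<open>1 < q\<close>] t1 \<omega>
      by (meson continuous_on_subset mono_on_subset)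
  qed
  with \<tau> blowup show ?thesis
    by blast
qed

end
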